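(* Let $G$ be a graph with a unique universal vertex $u$ (a vertex adjacent to all other vertices), and suppose $G\in\mathfrak{T}$. Then $W_\tau(G)\leq |V(G)|+2k(G)$, where $k(G)=\max_{v\in V(G),\,v\neq u} d_G(v)$.
   Context: All graphs are finite, undirected, without loops or multiple edges. A total coloring of a graph $G$ is an assignment of colors to the vertices and edges of $G$ such that no two adjacent vertices, no two adjacent edges, and no vertex and an edge incident to it receive the same color. For a positive integer $t$, an interval total $t$-coloring of $G$ is a total coloring of $G$ with colors $1,2,\ldots,t$ such that each color $i\in\{1,\ldots,t\}$ is used on at least one vertex or edge, and for each vertex $v$ the set consisting of the color of $v$ and the colors of the edges incident to $v$ consists of $d_G(v)+1$ consecutive integers, where $d_G(v)$ is the degree of $v$. $\mathfrak{T}$ is the set of graphs having an interval total $t$-coloring for some $t\geq1$, and for $G\in\mathfrak{T}$, $W_\tau(G)$ is the greatest such $t$. *)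

theory Defs
  imports Main
begin

definition simple_graph :: "'a set \<Rightarrow> 'a set set \<Rightarrow> bool" where
  "simple_graph V E \<longleftrightarrow> finite V \<and> (\<forall>e\<in>E. e \<subseteq> V \<and> card e = 2)"

definition incident_edges :: "'a set set \<Rightarrow> 'a \<Rightarrow> 'a set set" where
  "incident_edges E v = {e \<in> E. v \<in> e}"

definition degree :: "'a set set \<Rightarrow> 'a \<Rightarrow> nat" where
  "degree E v = card (incident_edges E v)"

definition universal_vertex :: "'a set \<Rightarrow> 'a set set \<Rightarrow> 'a \<Rightarrow> bool" where
  "universal_vertex V E u \<longleftrightarrow> u \<in> V \<and> (\<forall>v\<in>V. v \<noteq> u \<longrightarrow> {u, v} \<in> E)"

definition unique_universal_vertex :: "'a set \<Rightarrow> 'a set set \<Rightarrow> 'a \<Rightarrow> bool" where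
  "unique_universal_vertex V E u \<longleftrightarrow>
     universal_vertex V E u \<and> (\<forall>w. universal_vertex V E w \<longrightarrow> w = u)"

(* A coloring colors the disjoint union V <+> E: Inl v is the vertex v, Inr e the edge e.
   Its values outside V <+> E are irrelevant. *)
definition total_coloring ::
  "'a set \<Rightarrow> 'a set set \<Rightarrow> ('a + 'a set \<Rightarrow> nat) \<Rightarrow> bool" where
  "total_coloring V E c \<longleftrightarrow>
     (\<forall>v\<in>V. \<forall>w\<in>V. {v, w} \<in> E \<longrightarrow> c (Inl v) \<noteq> c (Inl w)) \<and>
     (\<forall>e\<in>E. \<forall>f\<in>E. e \<noteq> f \<and> e \<inter> f \<noteq> {} \<longrightarrow> c (Inr e) \<noteq> c (Inr f)) \<and>
     (\<forall>v\<in>V. \<forall>e\<in>incident_edges E v. c (Inl v) \<noteq> c (Inr e))"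

definition spectrum :: "'a set set \<Rightarrow> ('a + 'a set \<Rightarrow> nat) \<Rightarrow> 'a \<Rightarrow> nat set" where
  "spectrum E c v = insert (c (Inl v)) ((\<lambda>e. c (Inr e)) ` incident_edges E v)"

definition interval_total_coloring ::
  "'a set \<Rightarrow> 'a set set \<Rightarrow> nat \<Rightarrow> ('a + 'a set \<Rightarrow> nat) \<Rightarrow> bool" where
  "interval_total_coloring V E t c \<longleftrightarrow>
     total_coloring V E c \<and>
     c ` (V <+> E) = {1..t} \<and>
     (\<forall>v\<in>V. \<exists>a. spectrum E c v = {a..a + degree E v})"

definition interval_total_colorable_with :: "'a set \<Rightarrow> 'a set set \<Rightarrow> nat \<Rightarrow> bool" where
  "interval_total_colorable_with V E t \<longleftrightarrow>
     t \<ge> 1 \<and> (\<exists>c. interval_total_coloring V E t c)"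

definition interval_total_colorable :: "'a set \<Rightarrow> 'a set set \<Rightarrow> bool" where
  "interval_total_colorable V E \<longleftrightarrow> (\<exists>t. interval_total_colorable_with V E t)"

(* For a finite graph t is at most card V + card E, so the maximum is over a finite set. *)
definition W_tau :: "'a set \<Rightarrow> 'a set set \<Rightarrow> nat" where
  "W_tau V E = Max {t. interval_total_colorable_with V E t}"

(* Inserting 0 only matters when V = {u}: there the maximum over the empty set is taken to be 0. *)
definition max_degree_except :: "'a set \<Rightarrow> 'a set set \<Rightarrow> 'a \<Rightarrow> nat" where
  "max_degree_except V E u = Max (insert 0 (degree E ` (V - {u})))"

end

theory Submission imports Defs begin

text \<open>The spectrum of the universal vertex is an interval of at most \<open>card V\<close> colors, and the
  spectrum of any other vertex \<open>v\<close> is an interval of length \<open>degree E v\<close> which meets it in the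
  color of the edge \<open>{u, v}\<close>. Hence no color lies further than the maximum degree from the
  spectrum of the universal vertex, which bounds the distance between the colors 1 and \<open>t\<close>.\<close>

text \<open>Each edge at \<open>u\<close> has the form \<open>{u, v}\<close> with \<open>v\<close>
  in \<open>V - {u}\<close>, so there are no more such edges than elements of
  \<open>V - {u}\<close>.\<close>

lemma degree_less_card:
  assumes G: "simple_graph V E" and u: "u \<in> V"
  shows "degree E u < card V"
proof -
  have fin: "finite V" using G by (simp add: simple_graph_def)
  have "incident_edges E u \<subseteq> (\<lambda>v. {u, v}) ` (V - {u})"
  proof
    fix e assume "e \<in> incident_edges E u"
    then have e: "u \<in> e" "e \<subseteq> V" "card e = 2"
      using G by (auto simp: incident_edges_def simple_graph_def)
    then obtain v where "v \<noteq> u" "e = {u, v}"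
      unfolding card_2_iff by (metis insert_commute insert_iff singletonD)
    with e show "e \<in> (\<lambda>v. {u, v}) ` (V - {u})" by auto
  qed
  then have "degree E u \<le> card (V - {u})"
    unfolding degree_def using fin by (intro surj_card_le) auto
  then show ?thesis using fin u card_Diff1_less[of V u] by linarith
qed

lemma degree_le_max_degree_except:
  assumes "finite V" "v \<in> V" "v \<noteq> u"
  shows "degree E v \<le> max_degree_except V E u"
  using assms by (auto simp: max_degree_except_def intro: Max_ge)

text \<open>The color of an edge lies in the spectrum of each of its ends, so bounds on all spectra
  bound all colors.\<close>

lemma color_in_spectrum:
  assumes G: "simple_graph V E" and x: "x \<in> c ` (V <+> E)"
  shows "\<exists>v\<in>V. x \<in> spectrum E c v"
proof -
  from x consider v where "v \<in> V" "x = c (Inl v)" | e where "e \<in> E" "x = c (Inr e)"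
    by auto
  then show ?thesis
  proof cases
    case 1
    then show ?thesis by (auto simp: spectrum_def)
  next
    case 2
    with G obtain v where "v \<in> e" "v \<in> V" by (fastforce simp: simple_graph_def card_2_iff)
    with 2 show ?thesis by (auto simp: spectrum_def incident_edges_def)
  qed
qed

lemma interval_total_coloring_le:
  assumes G: "simple_graph V E" and U: "universal_vertex V E u"
    and t: "t \<ge> 1" and c: "interval_total_coloring V E t c"
  shows "t \<le> card V + 2 * max_degree_except V E u"
proof -
  let ?k = "max_degree_except V E u"
  have fin: "finite V" using G by (simp add: simple_graph_def)
  have u: "u \<in> V" using U by (simp add: universal_vertex_def)
  have colors: "c ` (V <+> E) = {1..t}"
    and interval: "\<And>v. v \<in> V \<Longrightarrow> \<exists>a. spectrum E c v = {a..a + degree E v}"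
    using c by (auto simp: interval_total_coloring_def)
  obtain a where a: "spectrum E c u = {a..a + degree E u}" using interval[OF u] by blast
  \<comment> \<open>The lower bound is written as a sum because subtraction on \<open>nat\<close>
    truncates at 0.\<close>
  have near: "a \<le> x + ?k \<and> x \<le> a + degree E u + ?k" if "x \<in> {1..t}" for x
  proof -
    from that colors have "x \<in> c ` (V <+> E)" by simp
    from color_in_spectrum[OF G this] obtain v where v: "v \<in> V" "x \<in> spectrum E c v" by blast
    show ?thesis
    proof (cases "v = u")
      case True
      then show ?thesis using v a by auto
    next
      case False
      obtain b where b: "spectrum E c v = {b..b + degree E v}" using interval[OF v(1)] by blast
      have "{u, v} \<in> E" using U v False by (auto simp: universal_vertex_def)
      then have "c (Inr {u, v}) \<in> spectrum E c u" "c (Inr {u, v}) \<in> spectrum E c v"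
        by (auto simp: spectrum_def incident_edges_def)
      then show ?thesis
        using v(2) degree_le_max_degree_except[OF fin v(1) False, of E] unfolding a b by auto
    qed
  qed
  \<comment> \<open>The color 1 gives \<open>a \<le> 1 + ?k\<close>, and the color \<open>t\<close>
    gives \<open>t \<le> a + degree E u + ?k\<close>. The extra 1 is absorbed by the strict
    inequality \<open>degree E u < card V\<close>.\<close>
  from near[of 1] near[of t] t degree_less_card[OF G u] show ?thesis by auto
qed

theorem theorem5:
  fixes V :: "'a set" and E :: "'a set set" and u :: 'a
  assumes "simple_graph V E"
    and "unique_universal_vertex V E u"
    and "interval_total_colorable V E"
  shows "W_tau V E \<le> card V + 2 * max_degree_except V E u"
proof -
  let ?T = "{t. interval_total_colorable_with V E t}"
  have bound: "t \<le> card V + 2 * max_degree_except V E u" if "t \<in> ?T" for t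
  proof -
    from that obtain c where c: "t \<ge> 1" "interval_total_coloring V E t c"
      by (auto simp: interval_total_colorable_with_def)
    have "universal_vertex V E u"
      using assms(2) by (simp add: unique_universal_vertex_def)
    then show ?thesis using c by (rule interval_total_coloring_le[OF assms(1)])
  qed
  \<comment> \<open>\<open>Max\<close> is meaningful only on a finite nonempty set: the bound itself
    yields finiteness, colorability yields an element.\<close>
  then have "?T \<subseteq> {..card V + 2 * max_degree_except V E u}" by blast
  then have "finite ?T" using finite_atMost by (rule finite_subset)
  moreover have "?T \<noteq> {}" using assms(3) by (auto simp: interval_total_colorable_def)
  ultimately show ?thesis unfolding W_tau_def using bound by simp
qed

end
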